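(* Let $M$ be an inverse monoid with identity $1_M$. Then the monoid $\mathrm{Sha}(M)$ of all order-preserving functions $\eta:M\to M$ such that $(ab^{-1}c)\eta=(a\eta)(b\eta)^{-1}(c\eta)$ for all $a,b,c\in M$ is isomorphic to the submonoid $$\mathrm{End}(M)\ltimes M=\{(\alpha,m)\in\mathrm{Hol}(M):\alpha\in\mathrm{End}(M)\}$$ of $\mathrm{Hol}(M)$.
   Context: Functions are written on the right and composed left to right. "Order-preserving" refers to the natural partial order on $M$ ($s\le t$ iff $s=te$ for some idempotent $e$). A premorphism $\theta:M\to M$ is a function with $(ab)\theta\le(a\theta)(b\theta)$ for all $a,b\in M$ (it need not preserve $1_M$); $\mathrm{Prem}(M)$ is the monoid of premorphisms. $\mathrm{End}(M)$ is the set of functions $\alpha:M\to M$ with $(ab)\alpha=(a\alpha)(b\alpha)$ for all $a,b\in M$ (not required to preserve $1_M$). For an inverse monoid the holomorph is described as $$\mathrm{Hol}(M)=\{(\alpha,m):\alpha\in\mathrm{Prem}(M),\ m\in M,\ mm^{-1}=1_M\alpha\},$$ a monoid under $(\alpha,m)\diamond(\beta,n)=(\alpha\beta,(m\beta)n)$. *)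

theory Defs
  imports "HOL-Algebra.Group"
begin

text \<open>Functions \<open>M \<rightarrow> M\<close> are represented as extensional functions on the carrier, so that equality
  of such functions is equality on the carrier.\<close>

locale inverse_monoid = monoid M for M (structure) +
  assumes unique_inverse:
    "a \<in> carrier M \<Longrightarrow> \<exists>!b. b \<in> carrier M \<and> a \<otimes> b \<otimes> a = a \<and> b \<otimes> a \<otimes> b = b"

text \<open>The inverse in the sense of inverse semigroups; it is not \<^const>\<open>m_inv\<close>, which is the
  two-sided group inverse of a unit.\<close>

definition sinv :: "('a, 'b) monoid_scheme \<Rightarrow> 'a \<Rightarrow> 'a" where
  "sinv M a = (THE b. b \<in> carrier M \<and> a \<otimes>\<^bsub>M\<^esub> b \<otimes>\<^bsub>M\<^esub> a = a \<and> b \<otimes>\<^bsub>M\<^esub> a \<otimes>\<^bsub>M\<^esub> b = b)"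

definition nat_le :: "('a, 'b) monoid_scheme \<Rightarrow> 'a \<Rightarrow> 'a \<Rightarrow> bool" where
  "nat_le M s t \<longleftrightarrow> (\<exists>e \<in> carrier M. e \<otimes>\<^bsub>M\<^esub> e = e \<and> s = t \<otimes>\<^bsub>M\<^esub> e)"

text \<open>Functions act on the right: the product of \<open>\<alpha>\<close> and \<open>\<beta>\<close> is ``first \<open>\<alpha>\<close>, then \<open>\<beta>\<close>'', whereas
  the library's \<^const>\<open>compose\<close> applies its last argument first.\<close>

definition fun_monoid :: "('a, 'b) monoid_scheme \<Rightarrow> ('a \<Rightarrow> 'a) set \<Rightarrow> ('a \<Rightarrow> 'a) monoid" where
  "fun_monoid M F =
     \<lparr>carrier = F,
      mult = (\<lambda>\<alpha> \<beta>. compose (carrier M) \<beta> \<alpha>),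
      one = (\<lambda>x \<in> carrier M. x)\<rparr>"

definition Prem :: "('a, 'b) monoid_scheme \<Rightarrow> ('a \<Rightarrow> 'a) monoid" where
  "Prem M = fun_monoid M
     {\<theta> \<in> carrier M \<rightarrow>\<^sub>E carrier M.
        \<forall>a \<in> carrier M. \<forall>b \<in> carrier M. nat_le M (\<theta> (a \<otimes>\<^bsub>M\<^esub> b)) (\<theta> a \<otimes>\<^bsub>M\<^esub> \<theta> b)}"

text \<open>Neither premorphisms nor endomorphisms are required to preserve the identity;
  \<^const>\<open>hom\<close> asks for multiplicativity only.\<close>

definition End :: "('a, 'b) monoid_scheme \<Rightarrow> ('a \<Rightarrow> 'a) set" where
  "End M = hom M M \<inter> extensional (carrier M)"

definition Hol :: "('a, 'b) monoid_scheme \<Rightarrow> (('a \<Rightarrow> 'a) \<times> 'a) monoid" where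
  "Hol M =
     \<lparr>carrier = {(\<alpha>, m). \<alpha> \<in> carrier (Prem M) \<and> m \<in> carrier M \<and> m \<otimes>\<^bsub>M\<^esub> sinv M m = \<alpha> \<one>\<^bsub>M\<^esub>},
      mult = (\<lambda>(\<alpha>, m) (\<beta>, n). (\<alpha> \<otimes>\<^bsub>Prem M\<^esub> \<beta>, \<beta> m \<otimes>\<^bsub>M\<^esub> n)),
      one = (\<one>\<^bsub>Prem M\<^esub>, \<one>\<^bsub>M\<^esub>)\<rparr>"

definition End_ltimes :: "('a, 'b) monoid_scheme \<Rightarrow> (('a \<Rightarrow> 'a) \<times> 'a) set" where
  "End_ltimes M = {(\<alpha>, m) \<in> carrier (Hol M). \<alpha> \<in> End M}"

definition Sha :: "('a, 'b) monoid_scheme \<Rightarrow> ('a \<Rightarrow> 'a) monoid" where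
  "Sha M = fun_monoid M
     {\<eta> \<in> carrier M \<rightarrow>\<^sub>E carrier M.
        (\<forall>s \<in> carrier M. \<forall>t \<in> carrier M. nat_le M s t \<longrightarrow> nat_le M (\<eta> s) (\<eta> t)) \<and>
        (\<forall>a \<in> carrier M. \<forall>b \<in> carrier M. \<forall>c \<in> carrier M.
           \<eta> (a \<otimes>\<^bsub>M\<^esub> sinv M b \<otimes>\<^bsub>M\<^esub> c) = \<eta> a \<otimes>\<^bsub>M\<^esub> sinv M (\<eta> b) \<otimes>\<^bsub>M\<^esub> \<eta> c)}"

end

theory Submission
  imports Defs
begin

text \<open>The isomorphism sends \<open>\<eta>\<close> to the pair \<open>(\<alpha>, m)\<close> with \<open>m = 1\<eta>\<close> and
  \<open>x\<alpha> = (x\<eta>)m\<^sup>-\<^sup>1\<close>; its inverse sends \<open>(\<alpha>, m)\<close> to \<open>x \<mapsto> (x\<alpha>)m\<close>. That \<open>Hol M\<close> is associative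
  although premorphisms are only submultiplicative rests on the fact that a premorphism \<open>\<gamma>\<close>
  satisfies \<open>(rn)\<gamma> = (r\<gamma>)(n\<gamma>)\<close> as soon as \<open>r = rnn\<^sup>-\<^sup>1\<close>.\<close>

section \<open>Inverse monoids\<close>

context inverse_monoid
begin

abbreviation sinverse ("\<iota> _" [81] 80) where "\<iota> a \<equiv> sinv M a"

abbreviation idem :: "'a \<Rightarrow> bool" where
  "idem e \<equiv> e \<in> carrier M \<and> e \<otimes> e = e"

abbreviation le (infix "\<preceq>" 50) where "s \<preceq> t \<equiv> nat_le M s t"

lemma sinv_props:
  assumes "a \<in> carrier M"
  shows "\<iota> a \<in> carrier M" "a \<otimes> \<iota> a \<otimes> a = a" "\<iota> a \<otimes> a \<otimes> \<iota> a = \<iota> a"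
  using theI'[OF unique_inverse[OF assms]] unfolding sinv_def by auto

lemmas sinv_closed [simp] = sinv_props(1)

lemma sinv_unique:
  assumes "a \<in> carrier M" "b \<in> carrier M" "a \<otimes> b \<otimes> a = a" "b \<otimes> a \<otimes> b = b"
  shows "\<iota> a = b"
  using unique_inverse[OF assms(1)] sinv_props[OF assms(1)] assms by blast

section \<open>Inverses of products and commuting idempotents\<close>

lemma sinv_sinv [simp]: "a \<in> carrier M \<Longrightarrow> \<iota> (\<iota> a) = a"
  by (rule sinv_unique) (auto simp: sinv_props)

lemma sinv_idem: "idem e \<Longrightarrow> \<iota> e = e"
  by (rule sinv_unique) auto

text \<open>The form of \<open>e \<otimes> e = e\<close> that still applies once
  \<open>m_assoc\<close> has nested products to the right.\<close>

lemma idem_absorb: "idem e \<Longrightarrow> y \<in> carrier M \<Longrightarrow> e \<otimes> (e \<otimes> y) = e \<otimes> y"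
  by (simp flip: m_assoc)

lemma idem_sinv_right: "a \<in> carrier M \<Longrightarrow> idem (a \<otimes> \<iota> a)"
  by (metis m_assoc m_closed sinv_props)

lemma idem_sinv_left: "a \<in> carrier M \<Longrightarrow> idem (\<iota> a \<otimes> a)"
  by (metis m_assoc m_closed sinv_props)

text \<open>With \<open>x\<close> the inverse of \<open>ef\<close>, also \<open>fxe\<close> is an inverse of \<open>ef\<close>; hence \<open>x = fxe\<close>,
  which is idempotent and therefore its own inverse \<open>ef\<close>.\<close>

lemma idem_mult:
  assumes e: "idem e" and f: "idem f"
  shows "idem (e \<otimes> f)"
proof -
  define x where "x = \<iota> (e \<otimes> f)"
  have c [simp]: "e \<in> carrier M" "f \<in> carrier M" "x \<in> carrier M"
    using e f by (auto simp: x_def)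
  have 1: "e \<otimes> (f \<otimes> (x \<otimes> (e \<otimes> f))) = e \<otimes> f"
    using sinv_props(2)[of "e \<otimes> f"] by (simp add: x_def m_assoc)
  have 2: "x \<otimes> (e \<otimes> (f \<otimes> x)) = x"
    using sinv_props(3)[of "e \<otimes> f"] by (simp add: x_def m_assoc)
  have 3: "x \<otimes> (e \<otimes> (f \<otimes> (x \<otimes> y))) = x \<otimes> y" if "y \<in> carrier M" for y
    using arg_cong[OF 2, of "\<lambda>z. z \<otimes> y"] that by (simp add: m_assoc)
  have "\<iota> (e \<otimes> f) = f \<otimes> x \<otimes> e"
    by (rule sinv_unique) (auto simp: m_assoc e f idem_absorb 1 3)
  then have x: "x = f \<otimes> x \<otimes> e"
    by (simp add: x_def)
  have "x \<otimes> x = f \<otimes> x \<otimes> e \<otimes> (f \<otimes> x \<otimes> e)"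
    by (subst (1 2) x) (rule refl)
  also have "\<dots> = f \<otimes> x \<otimes> e"
    by (simp add: m_assoc 3)
  finally have "idem x"
    by (simp flip: x)
  moreover have "\<iota> x = e \<otimes> f"
    by (simp add: x_def)
  ultimately show ?thesis
    using sinv_idem[of x] by simp
qed

text \<open>Since \<open>e \<otimes> f\<close> and \<open>f \<otimes> e\<close> are both idempotent,
  \<open>f \<otimes> e\<close> is an inverse of \<open>e \<otimes> f\<close>. But an idempotent is
  its own inverse, so uniqueness forces equality.\<close>

lemma idem_commute:
  assumes e: "idem e" and f: "idem f"
  shows "e \<otimes> f = f \<otimes> e"
proof -
  have c: "e \<in> carrier M" "f \<in> carrier M" and ef: "idem (e \<otimes> f)" and fe: "idem (f \<otimes> e)"
    using e f idem_mult by auto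
  have "\<iota> (e \<otimes> f) = f \<otimes> e"
  proof (rule sinv_unique)
    have "e \<otimes> f \<otimes> (f \<otimes> e) \<otimes> (e \<otimes> f) = e \<otimes> (f \<otimes> f) \<otimes> (e \<otimes> e) \<otimes> f"
      using c by (simp add: m_assoc)
    then show "e \<otimes> f \<otimes> (f \<otimes> e) \<otimes> (e \<otimes> f) = e \<otimes> f"
      using e f ef c by (simp add: m_assoc)
    have "f \<otimes> e \<otimes> (e \<otimes> f) \<otimes> (f \<otimes> e) = f \<otimes> (e \<otimes> e) \<otimes> (f \<otimes> f) \<otimes> e"
      using c by (simp add: m_assoc)
    then show "f \<otimes> e \<otimes> (e \<otimes> f) \<otimes> (f \<otimes> e) = f \<otimes> e"
      using e f fe c by (simp add: m_assoc)
  qed (use c in auto)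
  then show ?thesis
    using sinv_idem[OF ef] by simp
qed

text \<open>Swapping the commuting idempotents \<open>b \<otimes> \<iota> b\<close> and
  \<open>\<iota> a \<otimes> a\<close> reduces both inverse laws to those of \<open>a\<close> and
  \<open>b\<close>.\<close>

lemma sinv_mult:
  assumes a: "a \<in> carrier M" and b: "b \<in> carrier M"
  shows "\<iota> (a \<otimes> b) = \<iota> b \<otimes> \<iota> a"
proof (rule sinv_unique)
  have comm: "(b \<otimes> \<iota> b) \<otimes> (\<iota> a \<otimes> a) = (\<iota> a \<otimes> a) \<otimes> (b \<otimes> \<iota> b)"
    using a b by (intro idem_commute idem_sinv_left idem_sinv_right)
  have "a \<otimes> b \<otimes> (\<iota> b \<otimes> \<iota> a) \<otimes> (a \<otimes> b) = a \<otimes> ((b \<otimes> \<iota> b) \<otimes> (\<iota> a \<otimes> a)) \<otimes> b"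
    using a b by (simp add: m_assoc)
  also have "\<dots> = (a \<otimes> \<iota> a \<otimes> a) \<otimes> (b \<otimes> \<iota> b \<otimes> b)"
    unfolding comm using a b by (simp add: m_assoc)
  finally show "a \<otimes> b \<otimes> (\<iota> b \<otimes> \<iota> a) \<otimes> (a \<otimes> b) = a \<otimes> b"
    using a b by (simp add: sinv_props)
  have "\<iota> b \<otimes> \<iota> a \<otimes> (a \<otimes> b) \<otimes> (\<iota> b \<otimes> \<iota> a) = \<iota> b \<otimes> ((\<iota> a \<otimes> a) \<otimes> (b \<otimes> \<iota> b)) \<otimes> \<iota> a"
    using a b by (simp add: m_assoc)
  also have "\<dots> = (\<iota> b \<otimes> b \<otimes> \<iota> b) \<otimes> (\<iota> a \<otimes> a \<otimes> \<iota> a)"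
    unfolding comm[symmetric] using a b by (simp add: m_assoc)
  finally show "\<iota> b \<otimes> \<iota> a \<otimes> (a \<otimes> b) \<otimes> (\<iota> b \<otimes> \<iota> a) = \<iota> b \<otimes> \<iota> a"
    using a b by (simp add: sinv_props)
qed (use a b in auto)

text \<open>Lets an idempotent pass from the left of \<open>m\<close> to the right. The order is
  defined with idempotents on the right, and this gives access to those on the left.\<close>

lemma idem_conj:
  assumes m: "m \<in> carrier M" and e: "idem e"
  shows "idem (\<iota> m \<otimes> e \<otimes> m)" "e \<otimes> m = m \<otimes> (\<iota> m \<otimes> e \<otimes> m)"
proof -
  have "m \<otimes> (\<iota> m \<otimes> e \<otimes> m) = ((m \<otimes> \<iota> m) \<otimes> e) \<otimes> m"
    using m e by (simp add: m_assoc)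
  also have "\<dots> = (e \<otimes> (m \<otimes> \<iota> m)) \<otimes> m"
    using idem_commute[OF idem_sinv_right[OF m] e] by simp
  also have "\<dots> = e \<otimes> m"
    using m e sinv_props(2)[OF m] by (simp add: m_assoc)
  finally show 1: "e \<otimes> m = m \<otimes> (\<iota> m \<otimes> e \<otimes> m)" ..
  have "(\<iota> m \<otimes> e \<otimes> m) \<otimes> (\<iota> m \<otimes> e \<otimes> m) = \<iota> m \<otimes> e \<otimes> (m \<otimes> (\<iota> m \<otimes> e \<otimes> m))"
    using m e by (simp add: m_assoc)
  also have "\<dots> = \<iota> m \<otimes> e \<otimes> (e \<otimes> m)"
    by (simp add: 1)
  also have "\<dots> = \<iota> m \<otimes> e \<otimes> m"
    using m e by (simp add: m_assoc idem_absorb)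
  finally show "idem (\<iota> m \<otimes> e \<otimes> m)"
    using m e by simp
qed

lemma sinv_one [simp]: "\<iota> \<one> = \<one>"
  by (rule sinv_idem) auto

subsection \<open>The natural partial order\<close>

lemma nat_leI: "t \<in> carrier M \<Longrightarrow> idem e \<Longrightarrow> t \<otimes> e \<preceq> t"
  by (auto simp: nat_le_def)

lemma nat_le_refl: "t \<in> carrier M \<Longrightarrow> t \<preceq> t"
  using nat_leI[of t \<one>] by simp

lemma nat_le_mult_idem_left:
  assumes "t \<in> carrier M" "idem e"
  shows "e \<otimes> t \<preceq> t"
  using idem_conj[OF assms] nat_leI[OF assms(1)] by metis

text \<open>Replaces the unknown idempotent witness by one computed from \<open>s\<close>: if
  \<open>s = t \<otimes> e\<close>, then \<open>\<iota> s \<otimes> s = e \<otimes> (\<iota> t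
  \<otimes> t) \<otimes> e\<close>, and \<open>t\<close> absorbs its own idempotent after a
  swap.\<close>

lemma nat_le_eq:
  assumes t: "t \<in> carrier M" and le: "s \<preceq> t"
  shows "s = t \<otimes> (\<iota> s \<otimes> s)"
proof -
  obtain e where e: "idem e" and s: "s = t \<otimes> e"
    using le by (auto simp: nat_le_def)
  have "t \<otimes> (\<iota> s \<otimes> s) = t \<otimes> (e \<otimes> (\<iota> t \<otimes> t)) \<otimes> e"
    using t e by (simp add: s sinv_mult sinv_idem m_assoc)
  also have "\<dots> = t \<otimes> ((\<iota> t \<otimes> t) \<otimes> e) \<otimes> e"
    using idem_commute[OF e idem_sinv_left[OF t]] by simp
  also have "\<dots> = (t \<otimes> \<iota> t \<otimes> t) \<otimes> (e \<otimes> e)"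
    using t e by (simp add: m_assoc)
  finally show ?thesis
    using t e s by (simp add: sinv_props)
qed

lemma nat_le_trans:
  assumes "u \<in> carrier M" "s \<preceq> t" "t \<preceq> u"
  shows "s \<preceq> u"
proof -
  obtain e f where e: "idem e" "s = t \<otimes> e" and f: "idem f" "t = u \<otimes> f"
    using assms by (auto simp: nat_le_def)
  then have "s = u \<otimes> (f \<otimes> e)"
    using assms by (simp add: m_assoc)
  then show ?thesis
    using nat_leI[OF assms(1) idem_mult[OF f(1) e(1)]] by simp
qed

text \<open>With \<open>s = t \<otimes> e\<close> and \<open>t = s \<otimes> f\<close>, the element
  \<open>s\<close> absorbs \<open>e\<close>; hence \<open>s = s \<otimes> f \<otimes> e = s
  \<otimes> e \<otimes> f = s \<otimes> f = t\<close>.\<close>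

lemma nat_le_antisym:
  assumes s: "s \<in> carrier M" and "s \<preceq> t" "t \<preceq> s"
  shows "s = t"
proof -
  have t: "t \<in> carrier M"
    using s \<open>t \<preceq> s\<close> by (auto simp: nat_le_def)
  obtain e where e: "idem e" "s = t \<otimes> e"
    using \<open>s \<preceq> t\<close> by (auto simp: nat_le_def)
  have "s \<otimes> e = s"
    unfolding e(2) using e(1) t by (simp add: m_assoc)
  obtain f where f: "idem f" "t = s \<otimes> f"
    using \<open>t \<preceq> s\<close> by (auto simp: nat_le_def)
  have "s = s \<otimes> f \<otimes> e"
    unfolding f(2)[symmetric] by (rule e(2))
  also have "\<dots> = s \<otimes> e \<otimes> f"
    using idem_commute[OF e(1) f(1)] s e(1) f(1) by (simp add: m_assoc)
  finally show ?thesis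
    unfolding \<open>s \<otimes> e = s\<close> f(2)[symmetric] .
qed

lemma nat_le_mult_left:
  assumes "u \<in> carrier M" "t \<in> carrier M" "s \<preceq> t"
  shows "u \<otimes> s \<preceq> u \<otimes> t"
  using assms by (auto simp: nat_le_def m_assoc)

lemma nat_le_mult_right:
  assumes u: "u \<in> carrier M" and t: "t \<in> carrier M" and le: "s \<preceq> t"
  shows "s \<otimes> u \<preceq> t \<otimes> u"
proof -
  obtain e where e: "idem e" and s: "s = t \<otimes> e"
    using le by (auto simp: nat_le_def)
  have "t \<otimes> (e \<otimes> u) \<preceq> t \<otimes> u"
    using u t e by (intro nat_le_mult_left nat_le_mult_idem_left) auto
  then show ?thesis
    using u t e s by (simp add: m_assoc)
qed

section \<open>Premorphisms\<close>

text \<open>Membership in the carrier of \<open>Prem M\<close>, as a predicate;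
  \<open>carrier_Prem\<close> makes the link.\<close>

definition premorphism :: "('a \<Rightarrow> 'a) \<Rightarrow> bool" where
  "premorphism \<theta> \<longleftrightarrow> \<theta> \<in> carrier M \<rightarrow>\<^sub>E carrier M \<and>
     (\<forall>a\<in>carrier M. \<forall>b\<in>carrier M. \<theta> (a \<otimes> b) \<preceq> \<theta> a \<otimes> \<theta> b)"

lemma premorphism_closed: "premorphism \<theta> \<Longrightarrow> a \<in> carrier M \<Longrightarrow> \<theta> a \<in> carrier M"
  by (auto simp: premorphism_def)

lemma premorphism_extensional: "premorphism \<theta> \<Longrightarrow> \<theta> \<in> extensional (carrier M)"
  by (auto simp: premorphism_def PiE_def)

lemma premorphism_le:
  "premorphism \<theta> \<Longrightarrow> a \<in> carrier M \<Longrightarrow> b \<in> carrier M \<Longrightarrow> \<theta> (a \<otimes> b) \<preceq> \<theta> a \<otimes> \<theta> b"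
  by (auto simp: premorphism_def)

text \<open>From \<open>\<theta> e \<preceq> \<theta> e \<otimes> \<theta> e\<close>, the explicit
  witness of \<open>nat_le_eq\<close> is absorbed by the right-hand factor, which turns the
  inequality into an equation.\<close>

lemma premorphism_idem:
  assumes \<theta>: "premorphism \<theta>" and e: "idem e"
  shows "idem (\<theta> e)"
proof -
  have c: "\<theta> e \<in> carrier M"
    using \<theta> e premorphism_closed by auto
  have "\<theta> e \<preceq> \<theta> e \<otimes> \<theta> e"
    using premorphism_le[OF \<theta>, of e e] e by simp
  then have "\<theta> e = \<theta> e \<otimes> \<theta> e \<otimes> (\<iota> (\<theta> e) \<otimes> \<theta> e)"
    using c by (intro nat_le_eq) auto
  also have "\<dots> = \<theta> e \<otimes> (\<theta> e \<otimes> \<iota> (\<theta> e) \<otimes> \<theta> e)"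
    using c by (simp add: m_assoc)
  also have "\<dots> = \<theta> e \<otimes> \<theta> e"
    using c by (simp add: sinv_props)
  finally have "\<theta> e \<otimes> \<theta> e = \<theta> e" ..
  then show ?thesis
    using c by blast
qed

text \<open>If \<open>s = t \<otimes> e\<close>, then \<open>\<theta> s\<close> lies below
  \<open>\<theta> t \<otimes> \<theta> e\<close>, and \<open>\<theta> e\<close> is again
  idempotent.\<close>

lemma premorphism_mono:
  assumes \<theta>: "premorphism \<theta>" and t: "t \<in> carrier M" and le: "s \<preceq> t"
  shows "\<theta> s \<preceq> \<theta> t"
proof -
  obtain e where e: "idem e" and s: "s = t \<otimes> e"
    using le by (auto simp: nat_le_def)
  have 1: "\<theta> s \<preceq> \<theta> t \<otimes> \<theta> e"
    using premorphism_le[OF \<theta> t, of e] e s by simp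
  have 2: "\<theta> t \<otimes> \<theta> e \<preceq> \<theta> t"
    using premorphism_closed[OF \<theta> t] premorphism_idem[OF \<theta> e] by (rule nat_leI)
  show ?thesis
    using premorphism_closed[OF \<theta> t] 1 2 by (rule nat_le_trans)
qed

text \<open>Upgrades each of the two inequalities in \<open>premorphism_sinv\<close> to an inverse
  law: the witness \<open>\<iota> s \<otimes> s\<close> disappears into the last factor
  \<open>s\<close>.\<close>

lemma le_mult_mult_imp_eq:
  assumes s: "s \<in> carrier M" and u: "u \<in> carrier M" and le: "s \<preceq> s \<otimes> u \<otimes> s"
  shows "s \<otimes> u \<otimes> s = s"
proof -
  have "s = s \<otimes> u \<otimes> s \<otimes> (\<iota> s \<otimes> s)"
    using s u by (intro nat_le_eq[OF _ le]) auto
  also have "\<dots> = s \<otimes> u \<otimes> (s \<otimes> \<iota> s \<otimes> s)"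
    using s u by (simp add: m_assoc)
  also have "\<dots> = s \<otimes> u \<otimes> s"
    using s by (simp add: sinv_props)
  finally show ?thesis ..
qed

text \<open>Applying \<open>\<theta>\<close> to \<open>b = b \<otimes> \<iota> b \<otimes> b\<close>
  gives an inequality. Its instances at \<open>a\<close> and at \<open>\<iota> a\<close> become the
  two inverse laws, and inverses are unique.\<close>

lemma premorphism_sinv:
  assumes \<theta>: "premorphism \<theta>" and a: "a \<in> carrier M"
  shows "\<theta> (\<iota> a) = \<iota> (\<theta> a)"
proof -
  have le: "\<theta> b \<preceq> \<theta> b \<otimes> \<theta> (\<iota> b) \<otimes> \<theta> b" if b: "b \<in> carrier M" for b
  proof -
    have 1: "\<theta> b \<preceq> \<theta> (b \<otimes> \<iota> b) \<otimes> \<theta> b"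
      using b premorphism_le[OF \<theta>, of "b \<otimes> \<iota> b" b] by (simp add: sinv_props)
    have 2: "\<theta> (b \<otimes> \<iota> b) \<otimes> \<theta> b \<preceq> \<theta> b \<otimes> \<theta> (\<iota> b) \<otimes> \<theta> b"
      using b \<theta> by (intro nat_le_mult_right premorphism_le) (auto simp: premorphism_closed)
    show ?thesis
      using b \<theta> by (intro nat_le_trans[OF _ 1 2]) (simp add: premorphism_closed)
  qed
  have c: "\<theta> a \<in> carrier M" "\<theta> (\<iota> a) \<in> carrier M"
    using a \<theta> by (simp_all add: premorphism_closed)
  have "\<theta> (\<iota> a) \<preceq> \<theta> (\<iota> a) \<otimes> \<theta> a \<otimes> \<theta> (\<iota> a)"
    using le[of "\<iota> a"] a by simp
  then show ?thesis
    by (rule sinv_unique[OF c le_mult_mult_imp_eq[OF c le[OF a]]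
          le_mult_mult_imp_eq[OF c(2,1)], symmetric])
qed

lemma premorphism_mult_one:
  assumes \<theta>: "premorphism \<theta>" and a: "a \<in> carrier M"
  shows "\<theta> a \<otimes> \<theta> \<one> = \<theta> a"
proof (rule nat_le_antisym)
  show "\<theta> a \<otimes> \<theta> \<one> \<preceq> \<theta> a"
    using a \<theta> premorphism_idem[OF \<theta>, of \<one>] by (intro nat_leI) (auto simp: premorphism_closed)
  show "\<theta> a \<preceq> \<theta> a \<otimes> \<theta> \<one>"
    using premorphism_le[OF \<theta> a one_closed] a by simp
qed (use a \<theta> in \<open>auto simp: premorphism_closed\<close>)

text \<open>One inequality is submultiplicativity at \<open>a\<close> and \<open>\<iota> a\<close>.
  For the other, \<open>a = (a \<otimes> \<iota> a) \<otimes> a\<close> shows that the idempotent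
  \<open>\<theta> (a \<otimes> \<iota> a)\<close> fixes \<open>\<theta> a\<close> from the
  left.\<close>

lemma premorphism_range:
  assumes \<theta>: "premorphism \<theta>" and a: "a \<in> carrier M"
  shows "\<theta> (a \<otimes> \<iota> a) = \<theta> a \<otimes> \<iota> (\<theta> a)"
proof -
  define f where "f = \<theta> (a \<otimes> \<iota> a)"
  have c: "\<theta> a \<in> carrier M" "f \<in> carrier M"
    using a \<theta> by (auto simp: f_def premorphism_closed)
  have f: "idem f"
    unfolding f_def using premorphism_idem[OF \<theta>] idem_sinv_right[OF a] .
  have "\<theta> a \<preceq> f \<otimes> \<theta> a"
    using premorphism_le[OF \<theta>, of "a \<otimes> \<iota> a" a] a by (simp add: sinv_props f_def)
  then have "\<theta> a = f \<otimes> \<theta> a"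
    by (rule nat_le_antisym[OF c(1) _ nat_le_mult_idem_left[OF c(1) f]])
  then have "\<theta> a \<otimes> \<iota> (\<theta> a) = f \<otimes> (\<theta> a \<otimes> \<iota> (\<theta> a))"
    using c by (metis m_assoc sinv_closed)
  then have le: "\<theta> a \<otimes> \<iota> (\<theta> a) \<preceq> f"
    using nat_leI[OF c(2) idem_sinv_right[OF c(1)]] by simp
  have ge: "f \<preceq> \<theta> a \<otimes> \<iota> (\<theta> a)"
    using premorphism_le[OF \<theta>, of a "\<iota> a"] a premorphism_sinv[OF \<theta> a] by (simp add: f_def)
  show ?thesis
    using nat_le_antisym[OF c(2) ge le] by (simp add: f_def)
qed

text \<open>Here \<open>r\<close> is recovered as
  \<open>(r \<otimes> n) \<otimes> \<iota> n\<close>. So \<open>\<theta> r\<close> lies below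
  \<open>\<theta> (r \<otimes> n) \<otimes> \<iota> (\<theta> n)\<close>; multiplying by
  \<open>\<theta> n\<close> and dropping an idempotent gives the reverse of the premorphism
  inequality.\<close>

lemma premorphism_mult:
  assumes \<theta>: "premorphism \<theta>" and r: "r \<in> carrier M" and n: "n \<in> carrier M"
    and rn: "r \<otimes> (n \<otimes> \<iota> n) = r"
  shows "\<theta> (r \<otimes> n) = \<theta> r \<otimes> \<theta> n"
proof (rule nat_le_antisym)
  have c: "\<theta> r \<in> carrier M" "\<theta> n \<in> carrier M" "\<theta> (r \<otimes> n) \<in> carrier M"
    using r n \<theta> by (auto simp: premorphism_closed)
  show "\<theta> (r \<otimes> n) \<preceq> \<theta> r \<otimes> \<theta> n"
    using r n by (intro premorphism_le[OF \<theta>])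
  have "\<theta> r \<preceq> \<theta> (r \<otimes> n) \<otimes> \<iota> (\<theta> n)"
    using premorphism_le[OF \<theta>, of "r \<otimes> n" "\<iota> n"] r n rn premorphism_sinv[OF \<theta> n]
    by (simp add: m_assoc)
  then have "\<theta> r \<otimes> \<theta> n \<preceq> \<theta> (r \<otimes> n) \<otimes> \<iota> (\<theta> n) \<otimes> \<theta> n"
    using c by (intro nat_le_mult_right) auto
  then have 1: "\<theta> r \<otimes> \<theta> n \<preceq> \<theta> (r \<otimes> n) \<otimes> (\<iota> (\<theta> n) \<otimes> \<theta> n)"
    using c by (simp add: m_assoc)
  have 2: "\<theta> (r \<otimes> n) \<otimes> (\<iota> (\<theta> n) \<otimes> \<theta> n) \<preceq> \<theta> (r \<otimes> n)"
    using c by (intro nat_leI idem_sinv_left)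
  show "\<theta> r \<otimes> \<theta> n \<preceq> \<theta> (r \<otimes> n)"
    using c(3) 1 2 by (rule nat_le_trans)
qed (use r n \<theta> in \<open>auto simp: premorphism_closed\<close>)

section \<open>Composition of premorphisms, and endomorphisms among them\<close>

lemma premorphism_id: "premorphism (\<lambda>x\<in>carrier M. x)"
  by (auto simp: premorphism_def nat_le_refl)

lemma premorphism_compose:
  assumes \<theta>: "premorphism \<theta>" and \<phi>: "premorphism \<phi>"
  shows "premorphism (compose (carrier M) \<phi> \<theta>)"
  unfolding premorphism_def
proof (intro conjI ballI)
  show "compose (carrier M) \<phi> \<theta> \<in> carrier M \<rightarrow>\<^sub>E carrier M"
    using \<theta> \<phi> by (auto simp: compose_def premorphism_closed)
  fix a b assume ab: "a \<in> carrier M" "b \<in> carrier M"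
  \<comment> \<open>Monotonicity of \<open>\<phi>\<close> is what carries the inequality for
    \<open>\<theta>\<close> through.\<close>
  have 1: "\<phi> (\<theta> (a \<otimes> b)) \<preceq> \<phi> (\<theta> a \<otimes> \<theta> b)"
    using ab \<theta> by (intro premorphism_mono[OF \<phi>] premorphism_le) (auto simp: premorphism_closed)
  have 2: "\<phi> (\<theta> a \<otimes> \<theta> b) \<preceq> \<phi> (\<theta> a) \<otimes> \<phi> (\<theta> b)"
    using ab \<theta> by (intro premorphism_le[OF \<phi>]) (auto simp: premorphism_closed)
  have "\<phi> (\<theta> (a \<otimes> b)) \<preceq> \<phi> (\<theta> a) \<otimes> \<phi> (\<theta> b)"
    using ab \<theta> \<phi> by (intro nat_le_trans[OF _ 1 2]) (simp add: premorphism_closed)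
  then show "compose (carrier M) \<phi> \<theta> (a \<otimes> b)
      \<preceq> compose (carrier M) \<phi> \<theta> a \<otimes> compose (carrier M) \<phi> \<theta> b"
    using ab by (simp add: compose_def)
qed

lemma premorphism_End:
  assumes "\<alpha> \<in> End M"
  shows "premorphism \<alpha>"
  using assms unfolding premorphism_def End_def hom_def
  by (auto simp: PiE_def Pi_iff nat_le_refl)

lemma End_compose:
  assumes "\<alpha> \<in> End M" "\<beta> \<in> End M"
  shows "compose (carrier M) \<beta> \<alpha> \<in> End M"
  using assms by (simp add: End_def hom_def Pi_iff compose_def)

section \<open>The holomorph\<close>

lemma carrier_Prem: "carrier (Prem M) = {\<theta>. premorphism \<theta>}"
  by (simp add: Prem_def fun_monoid_def premorphism_def)

lemma mem_Hol:
  "(\<alpha>, m) \<in> carrier (Hol M) \<longleftrightarrow> premorphism \<alpha> \<and> m \<in> carrier M \<and> m \<otimes> \<iota> m = \<alpha> \<one>"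
  by (simp add: Hol_def carrier_Prem)

lemma mult_Hol:
  "(\<alpha>, m) \<otimes>\<^bsub>Hol M\<^esub> (\<beta>, n) = (compose (carrier M) \<beta> \<alpha>, \<beta> m \<otimes> n)"
  by (simp add: Hol_def Prem_def fun_monoid_def)

lemma one_Hol: "\<one>\<^bsub>Hol M\<^esub> = (\<lambda>x\<in>carrier M. x, \<one>)"
  by (simp add: Hol_def Prem_def fun_monoid_def)

text \<open>In the new range idempotent the inner
  \<open>n \<otimes> \<iota> n = \<beta> \<one>\<close> is absorbed by \<open>\<beta> m\<close>.
  What remains is \<open>\<beta> (m \<otimes> \<iota> m) = \<beta> (\<alpha> \<one>)\<close> by
  \<open>premorphism_range\<close>.\<close>

lemma Hol_closed:
  assumes "(\<alpha>, m) \<in> carrier (Hol M)" "(\<beta>, n) \<in> carrier (Hol M)"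
  shows "(compose (carrier M) \<beta> \<alpha>, \<beta> m \<otimes> n) \<in> carrier (Hol M)"
proof -
  have \<alpha>: "premorphism \<alpha>" and m: "m \<in> carrier M" "m \<otimes> \<iota> m = \<alpha> \<one>"
    and \<beta>: "premorphism \<beta>" and n: "n \<in> carrier M" "n \<otimes> \<iota> n = \<beta> \<one>"
    using assms by (auto simp: mem_Hol)
  have c: "\<beta> m \<in> carrier M" "\<beta> \<one> \<in> carrier M"
    using m \<beta> by (auto simp: premorphism_closed)
  have "(\<beta> m \<otimes> n) \<otimes> \<iota> (\<beta> m \<otimes> n) = \<beta> m \<otimes> (n \<otimes> \<iota> n) \<otimes> \<iota> (\<beta> m)"
    using c n(1) by (simp add: sinv_mult m_assoc)
  also have "\<dots> = \<beta> m \<otimes> \<iota> (\<beta> m)"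
    using n(2) premorphism_mult_one[OF \<beta> m(1)] by simp
  also have "\<dots> = \<beta> (\<alpha> \<one>)"
    using premorphism_range[OF \<beta> m(1)] m(2) by simp
  finally show ?thesis
    using premorphism_compose[OF \<alpha> \<beta>] n(1) c by (simp add: mem_Hol compose_eq)
qed

lemma monoid_Hol: "monoid (Hol M)"
proof
  fix x y assume "x \<in> carrier (Hol M)" "y \<in> carrier (Hol M)"
  then show "x \<otimes>\<^bsub>Hol M\<^esub> y \<in> carrier (Hol M)"
    by (cases x; cases y) (simp add: mult_Hol Hol_closed)
next
  fix x y z assume "x \<in> carrier (Hol M)" "y \<in> carrier (Hol M)" "z \<in> carrier (Hol M)"
  moreover obtain \<alpha> m \<beta> n \<gamma> p where xyz: "x = (\<alpha>, m)" "y = (\<beta>, n)" "z = (\<gamma>, p)"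
    by (cases x; cases y; cases z)
  ultimately have \<alpha>: "premorphism \<alpha>" "m \<in> carrier M" and \<beta>: "premorphism \<beta>"
    and n: "n \<in> carrier M" "n \<otimes> \<iota> n = \<beta> \<one>" and \<gamma>: "premorphism \<gamma>" "p \<in> carrier M"
    by (auto simp: mem_Hol)
  \<comment> \<open>The side condition of \<open>premorphism_mult\<close> for
    \<open>r = \<beta> m\<close> holds because
    \<open>n \<otimes> \<iota> n = \<beta> \<one>\<close>, which \<open>\<beta> m\<close>
    absorbs.\<close>
  have "\<gamma> (\<beta> m \<otimes> n) = \<gamma> (\<beta> m) \<otimes> \<gamma> n"
    using \<alpha> \<beta> n \<gamma> premorphism_mult_one[OF \<beta> \<alpha>(2)]
    by (intro premorphism_mult) (auto simp: premorphism_closed)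
  then have "\<gamma> (\<beta> m \<otimes> n) \<otimes> p = compose (carrier M) \<gamma> \<beta> m \<otimes> (\<gamma> n \<otimes> p)"
    using \<alpha> \<beta> n \<gamma> by (simp add: m_assoc premorphism_closed compose_def)
  moreover have "compose (carrier M) \<gamma> (compose (carrier M) \<beta> \<alpha>)
      = compose (carrier M) (compose (carrier M) \<gamma> \<beta>) \<alpha>"
    using \<alpha> by (intro compose_assoc[of _ _ "carrier M"]) (auto simp: premorphism_closed)
  ultimately show "x \<otimes>\<^bsub>Hol M\<^esub> y \<otimes>\<^bsub>Hol M\<^esub> z = x \<otimes>\<^bsub>Hol M\<^esub> (y \<otimes>\<^bsub>Hol M\<^esub> z)"
    by (simp add: xyz mult_Hol)
next
  show "\<one>\<^bsub>Hol M\<^esub> \<in> carrier (Hol M)"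
    by (simp add: one_Hol mem_Hol premorphism_id)
next
  fix x assume "x \<in> carrier (Hol M)"
  moreover obtain \<alpha> m where x: "x = (\<alpha>, m)"
    by (cases x)
  ultimately have \<alpha>: "premorphism \<alpha>" and m: "m \<in> carrier M" "m \<otimes> \<iota> m = \<alpha> \<one>"
    by (auto simp: mem_Hol)
  have ext: "\<alpha> \<in> carrier M \<rightarrow> carrier M" "\<alpha> \<in> extensional (carrier M)"
    using \<alpha> by (auto simp: premorphism_closed premorphism_extensional)
  \<comment> \<open>The second component of the left unit law: \<open>\<alpha> \<one>\<close> is
    \<open>m \<otimes> \<iota> m\<close>.\<close>
  have "\<alpha> \<one> \<otimes> m = m"
    using m sinv_props by metis
  then show "\<one>\<^bsub>Hol M\<^esub> \<otimes>\<^bsub>Hol M\<^esub> x = x" "x \<otimes>\<^bsub>Hol M\<^esub> \<one>\<^bsub>Hol M\<^esub> = x"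
    using ext m by (simp_all add: x one_Hol mult_Hol compose_Id Id_compose)
qed

lemma submonoid_End_ltimes: "submonoid (End_ltimes M) (Hol M)"
proof
  show "End_ltimes M \<subseteq> carrier (Hol M)"
    by (auto simp: End_ltimes_def)
  show "\<one>\<^bsub>Hol M\<^esub> \<in> End_ltimes M"
    using monoid.one_closed[OF monoid_Hol]
    by (auto simp: End_ltimes_def one_Hol End_def hom_def)
  fix x y assume xy: "x \<in> End_ltimes M" "y \<in> End_ltimes M"
  then have "x \<otimes>\<^bsub>Hol M\<^esub> y \<in> carrier (Hol M)"
    by (intro monoid.m_closed[OF monoid_Hol]) (auto simp: End_ltimes_def)
  with xy show "x \<otimes>\<^bsub>Hol M\<^esub> y \<in> End_ltimes M"
    by (cases x; cases y) (simp add: End_ltimes_def mult_Hol End_compose)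
qed

section \<open>The isomorphism\<close>

lemma mem_Sha:
  "\<eta> \<in> carrier (Sha M) \<longleftrightarrow> \<eta> \<in> carrier M \<rightarrow>\<^sub>E carrier M \<and>
     (\<forall>s\<in>carrier M. \<forall>t\<in>carrier M. s \<preceq> t \<longrightarrow> \<eta> s \<preceq> \<eta> t) \<and>
     (\<forall>a\<in>carrier M. \<forall>b\<in>carrier M. \<forall>c\<in>carrier M.
        \<eta> (a \<otimes> \<iota> b \<otimes> c) = \<eta> a \<otimes> \<iota> (\<eta> b) \<otimes> \<eta> c)"
  by (simp add: Sha_def fun_monoid_def)

lemma Sha_ternary:
  "\<eta> \<in> carrier (Sha M) \<Longrightarrow> a \<in> carrier M \<Longrightarrow> b \<in> carrier M \<Longrightarrow> c \<in> carrier M \<Longrightarrow>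
     \<eta> (a \<otimes> \<iota> b \<otimes> c) = \<eta> a \<otimes> \<iota> (\<eta> b) \<otimes> \<eta> c"
  by (simp add: mem_Sha)

lemma Sha_closed: "\<eta> \<in> carrier (Sha M) \<Longrightarrow> a \<in> carrier M \<Longrightarrow> \<eta> a \<in> carrier M"
  by (auto simp: mem_Sha)

lemma Sha_extensional: "\<eta> \<in> carrier (Sha M) \<Longrightarrow> \<eta> \<in> extensional (carrier M)"
  by (auto simp: mem_Sha PiE_def)

lemma mult_Sha: "\<eta> \<otimes>\<^bsub>Sha M\<^esub> \<zeta> = compose (carrier M) \<zeta> \<eta>"
  by (simp add: Sha_def fun_monoid_def)

lemma one_Sha: "\<one>\<^bsub>Sha M\<^esub> = (\<lambda>x\<in>carrier M. x)"
  by (simp add: Sha_def fun_monoid_def)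

lemma monoid_Sha: "monoid (Sha M)"
proof
  fix \<eta> \<zeta> assume "\<eta> \<in> carrier (Sha M)" "\<zeta> \<in> carrier (Sha M)"
  then show "\<eta> \<otimes>\<^bsub>Sha M\<^esub> \<zeta> \<in> carrier (Sha M)"
    by (auto simp: mult_Sha mem_Sha compose_def PiE_def Pi_iff)
next
  fix \<eta> \<zeta> \<xi> assume "\<eta> \<in> carrier (Sha M)" "\<zeta> \<in> carrier (Sha M)" "\<xi> \<in> carrier (Sha M)"
  then show "\<eta> \<otimes>\<^bsub>Sha M\<^esub> \<zeta> \<otimes>\<^bsub>Sha M\<^esub> \<xi> = \<eta> \<otimes>\<^bsub>Sha M\<^esub> (\<zeta> \<otimes>\<^bsub>Sha M\<^esub> \<xi>)"
    unfolding mult_Sha by (intro compose_assoc[of _ _ "carrier M"]) (auto simp: Sha_closed)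
next
  show "\<one>\<^bsub>Sha M\<^esub> \<in> carrier (Sha M)"
    by (auto simp: one_Sha mem_Sha)
next
  fix \<eta> assume "\<eta> \<in> carrier (Sha M)"
  then have "\<eta> \<in> carrier M \<rightarrow> carrier M" "\<eta> \<in> extensional (carrier M)"
    by (auto simp: Sha_closed Sha_extensional)
  then show "\<one>\<^bsub>Sha M\<^esub> \<otimes>\<^bsub>Sha M\<^esub> \<eta> = \<eta>" "\<eta> \<otimes>\<^bsub>Sha M\<^esub> \<one>\<^bsub>Sha M\<^esub> = \<eta>"
    by (simp_all add: one_Sha mult_Sha compose_Id Id_compose)
qed

text \<open>When \<open>M\<close> is a group, this splits an affine map into an endomorphism and a
  right translation.\<close>

definition to_pair :: "('a \<Rightarrow> 'a) \<Rightarrow> ('a \<Rightarrow> 'a) \<times> 'a" where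
  "to_pair \<eta> = (\<lambda>x\<in>carrier M. \<eta> x \<otimes> \<iota> (\<eta> \<one>), \<eta> \<one>)"

definition of_pair :: "('a \<Rightarrow> 'a) \<times> 'a \<Rightarrow> 'a \<Rightarrow> 'a" where
  "of_pair = (\<lambda>(\<alpha>, m). \<lambda>x\<in>carrier M. \<alpha> x \<otimes> m)"

text \<open>The ternary law at \<open>(a, \<one>, \<one>)\<close>. It is what lets
  \<open>of_pair\<close> recover \<open>\<eta>\<close> from \<open>to_pair \<eta>\<close>.\<close>

lemma Sha_one_right:
  assumes "\<eta> \<in> carrier (Sha M)" "a \<in> carrier M"
  shows "\<eta> a \<otimes> \<iota> (\<eta> \<one>) \<otimes> \<eta> \<one> = \<eta> a"
  using Sha_ternary[OF assms one_closed one_closed] assms by simp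

lemma Sha_one_left:
  assumes "\<eta> \<in> carrier (Sha M)" "a \<in> carrier M"
  shows "\<eta> \<one> \<otimes> \<iota> (\<eta> \<one>) \<otimes> \<eta> a = \<eta> a"
  using Sha_ternary[OF assms(1) one_closed one_closed assms(2)] assms by simp

text \<open>Multiplicativity is the ternary law at \<open>(a, \<one>, b)\<close>. The first
  component takes \<open>\<one>\<close> to
  \<open>\<eta> \<one> \<otimes> \<iota> (\<eta> \<one>)\<close>, exactly as \<open>Hol M\<close>
  demands.\<close>

lemma to_pair_mem:
  assumes \<eta>: "\<eta> \<in> carrier (Sha M)"
  shows "to_pair \<eta> \<in> End_ltimes M"
proof -
  have "\<eta> (a \<otimes> b) \<otimes> \<iota> (\<eta> \<one>) = \<eta> a \<otimes> \<iota> (\<eta> \<one>) \<otimes> (\<eta> b \<otimes> \<iota> (\<eta> \<one>))"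
    if "a \<in> carrier M" "b \<in> carrier M" for a b
    using Sha_ternary[OF \<eta>, of a \<one> b] that by (simp add: m_assoc Sha_closed[OF \<eta>])
  then have "(\<lambda>x\<in>carrier M. \<eta> x \<otimes> \<iota> (\<eta> \<one>)) \<in> End M"
    by (auto simp: End_def hom_def Sha_closed[OF \<eta>])
  then show ?thesis
    by (auto simp: to_pair_def End_ltimes_def mem_Hol premorphism_End Sha_closed[OF \<eta>])
qed

lemma of_pair_mem:
  assumes "p \<in> End_ltimes M"
  shows "of_pair p \<in> carrier (Sha M)"
proof -
  obtain \<alpha> m where p: "p = (\<alpha>, m)"
    by (cases p)
  have E: "\<alpha> \<in> End M" and m: "m \<in> carrier M" "m \<otimes> \<iota> m = \<alpha> \<one>"
    using assms by (auto simp: p End_ltimes_def mem_Hol)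
  note \<alpha> = premorphism_End[OF E]
  note c = premorphism_closed[OF \<alpha>]
  have hom: "\<alpha> (a \<otimes> b) = \<alpha> a \<otimes> \<alpha> b" if "a \<in> carrier M" "b \<in> carrier M" for a b
    using E that by (simp add: End_def hom_mult)
  have "\<alpha> s \<otimes> m \<preceq> \<alpha> t \<otimes> m" if "t \<in> carrier M" "s \<preceq> t" for s t
    using that m by (intro nat_le_mult_right premorphism_mono[OF \<alpha>]) (auto simp: c)
  moreover have "\<alpha> (x \<otimes> \<iota> y \<otimes> z) \<otimes> m = \<alpha> x \<otimes> m \<otimes> \<iota> (\<alpha> y \<otimes> m) \<otimes> (\<alpha> z \<otimes> m)"
    if "x \<in> carrier M" "y \<in> carrier M" "z \<in> carrier M" for x y z
  proof -
    \<comment> \<open>The two copies of \<open>m\<close> meet as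
      \<open>m \<otimes> \<iota> m = \<alpha> \<one>\<close>, which \<open>\<alpha> x\<close>
      absorbs; only the final \<open>m\<close> survives.\<close>
    have "\<alpha> x \<otimes> m \<otimes> \<iota> (\<alpha> y \<otimes> m) \<otimes> (\<alpha> z \<otimes> m) = \<alpha> x \<otimes> (m \<otimes> \<iota> m) \<otimes> \<iota> (\<alpha> y) \<otimes> \<alpha> z \<otimes> m"
      using that m(1) by (simp add: c sinv_mult m_assoc)
    also have "\<dots> = \<alpha> x \<otimes> \<alpha> (\<iota> y) \<otimes> \<alpha> z \<otimes> m"
      using that by (simp add: m(2) premorphism_mult_one[OF \<alpha>] premorphism_sinv[OF \<alpha>])
    finally show ?thesis
      using that by (simp add: hom)
  qed
  ultimately show ?thesis
    using m by (auto simp: mem_Sha p of_pair_def c)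
qed

lemma of_pair_to_pair:
  assumes "\<eta> \<in> carrier (Sha M)"
  shows "of_pair (to_pair \<eta>) = \<eta>"
proof (rule extensionalityI[of _ "carrier M"])
  show "\<eta> \<in> extensional (carrier M)"
    using assms by (rule Sha_extensional)
qed (auto simp: of_pair_def to_pair_def Sha_one_right[OF assms])

text \<open>The condition \<open>m \<otimes> \<iota> m = \<alpha> \<one>\<close> is used twice:
  \<open>\<alpha> \<one> \<otimes> m = m\<close> returns \<open>m\<close>, and
  \<open>\<alpha> x \<otimes> \<alpha> \<one> = \<alpha> x\<close> returns
  \<open>\<alpha>\<close>.\<close>

lemma to_pair_of_pair:
  assumes "p \<in> End_ltimes M"
  shows "to_pair (of_pair p) = p"
proof -
  obtain \<alpha> m where p: "p = (\<alpha>, m)"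
    by (cases p)
  have \<alpha>: "premorphism \<alpha>" and m: "m \<in> carrier M" "m \<otimes> \<iota> m = \<alpha> \<one>"
    using assms by (auto simp: p End_ltimes_def mem_Hol)
  have 1: "\<alpha> \<one> \<otimes> m = m"
    using m sinv_props by metis
  have "(\<lambda>x\<in>carrier M. \<alpha> x \<otimes> m \<otimes> \<iota> m) = \<alpha>"
  proof (rule extensionalityI[of _ "carrier M"])
    show "\<alpha> \<in> extensional (carrier M)"
      using \<alpha> by (rule premorphism_extensional)
  qed (use \<alpha> m in \<open>auto simp: m_assoc premorphism_closed premorphism_mult_one\<close>)
  moreover have "to_pair (of_pair p) = (\<lambda>x\<in>carrier M. \<alpha> x \<otimes> m \<otimes> \<iota> m, m)"
    by (auto simp: to_pair_def of_pair_def p 1)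
  ultimately show ?thesis
    by (simp add: p)
qed

lemma to_pair_mult:
  assumes \<eta>: "\<eta> \<in> carrier (Sha M)" and \<zeta>: "\<zeta> \<in> carrier (Sha M)"
  shows "to_pair (\<eta> \<otimes>\<^bsub>Sha M\<^esub> \<zeta>) = to_pair \<eta> \<otimes>\<^bsub>Hol M\<^esub> to_pair \<zeta>"
proof -
  note c = Sha_closed[OF \<eta>] Sha_closed[OF \<zeta>]
  \<comment> \<open>\<open>Sha_one_left\<close> with both sides inverted.\<close>
  have inv: "\<iota> (\<zeta> y) \<otimes> (\<zeta> \<one> \<otimes> \<iota> (\<zeta> \<one>)) = \<iota> (\<zeta> y)" if "y \<in> carrier M" for y
    using arg_cong[OF Sha_one_left[OF \<zeta> that], of "sinv M"] that
    by (simp add: c sinv_mult m_assoc)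
  \<comment> \<open>First components agree: the ternary law at
    \<open>(\<eta> x, \<eta> \<one>, \<one>)\<close> leaves a trailing
    \<open>\<zeta> \<one> \<otimes> \<iota> (\<zeta> \<one>)\<close>, which \<open>inv\<close>
    removes. Second components agree by \<open>Sha_one_right\<close>.\<close>
  have "\<zeta> (\<eta> x \<otimes> \<iota> (\<eta> \<one>)) \<otimes> \<iota> (\<zeta> \<one>) = \<zeta> (\<eta> x) \<otimes> \<iota> (\<zeta> (\<eta> \<one>))" if "x \<in> carrier M" for x
    using Sha_ternary[OF \<zeta>, of "\<eta> x" "\<eta> \<one>" \<one>] inv[of "\<eta> \<one>"] that by (simp add: c m_assoc)
  then show ?thesis
    by (auto simp: to_pair_def mult_Sha mult_Hol compose_def c Sha_one_right[OF \<zeta>]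
        intro!: restrict_ext)
qed

lemma to_pair_iso: "to_pair \<in> iso (Sha M) ((Hol M)\<lparr>carrier := End_ltimes M\<rparr>)"
proof -
  have "bij_betw to_pair (carrier (Sha M)) (End_ltimes M)"
    by (rule bij_betwI[where g = of_pair])
      (auto simp: to_pair_mem of_pair_mem of_pair_to_pair to_pair_of_pair)
  then show ?thesis
    by (simp add: iso_def hom_def to_pair_mem to_pair_mult)
qed

end

theorem proposition4p3:
  fixes M :: "('a, 'b) monoid_scheme"
  assumes "inverse_monoid M"
  shows "monoid (Sha M) \<and> monoid (Hol M) \<and> submonoid (End_ltimes M) (Hol M) \<and>
         Sha M \<cong> (Hol M)\<lparr>carrier := End_ltimes M\<rparr>"
proof -
  interpret inverse_monoid M by fact
  show ?thesis
    using monoid_Sha monoid_Hol submonoid_End_ltimes to_pair_iso by (auto simp: is_iso_def)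
qed

end
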